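(* Let $M=(m_{i,j})_{i,j\ge1}$ be an infinite integer-valued lower-triangular matrix with $1$'s on the diagonal. Then $\tilde M_1^{-1}$ is an eigentriangle of $M$. Explicitly: writing $\tilde M_1^{-1}=(r_{i,j})_{i,j\ge 1}$, which is lower-triangular with $r_{i,i}=1$ and $r_{i+1,i}=1$ for all $i\ge1$, the product $M\tilde M_1^{-1}$ is the lower-triangular matrix whose $(i,j)$ entry is $r_{i+1,j}$ for all $i\ge j\ge 1$ (in particular its diagonal entries are $1$) and $0$ for $i<j$.
   Context: For $M=(m_{i,j})_{i,j\ge1}$ lower-triangular with $1$'s on the diagonal, $\tilde M_1$ denotes the lower-triangular matrix whose $(i,j)$ entry is: $1$ if $i=j$; $-1$ if $i=j+1$; $-m_{i-1,j}$ if $i\ge j+2$; and $0$ if $i<j$. A matrix $R=(r_{i,j})_{i,j\ge1}$ that is lower-triangular with $1$'s on the diagonal and on the first subdiagonal is called an eigentriangle of $M$ if $MR$ is the lower-triangular matrix with $(i,j)$ entry $r_{i+1,j}$ for $i\ge j$. *)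

theory Defs imports Main begin

text \<open>
  An infinite integer matrix is a function of the row index and the column index, both ranging over
  the positive integers. The values at index 0 carry no meaning: every notion below only looks at
  indices \<open>\<ge> 1\<close>.
\<close>

type_synonym infmat = "nat \<Rightarrow> nat \<Rightarrow> int"

definition lower_triangular :: "infmat \<Rightarrow> bool" where
  "lower_triangular A \<longleftrightarrow> (\<forall>i\<ge>1. \<forall>j\<ge>1. i < j \<longrightarrow> A i j = 0)"

definition row_finite :: "infmat \<Rightarrow> bool" where
  "row_finite A \<longleftrightarrow> (\<forall>i\<ge>1. finite {k. 1 \<le> k \<and> A i k \<noteq> 0})"

text \<open>
  The usual matrix product, with the zero entries of row \<open>i\<close> of the left factor left out of the sum.
  The sum is finite whenever the left factor is row-finite, in particular when it is lower-triangular.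
\<close>

definition infmat_mult :: "infmat \<Rightarrow> infmat \<Rightarrow> infmat" where
  "infmat_mult A B = (\<lambda>i j. \<Sum>k | 1 \<le> k \<and> A i k \<noteq> 0. A i k * B k j)"

definition is_identity :: "infmat \<Rightarrow> bool" where
  "is_identity A \<longleftrightarrow> (\<forall>i\<ge>1. \<forall>j\<ge>1. A i j = (if i = j then 1 else 0))"

definition is_inverse :: "infmat \<Rightarrow> infmat \<Rightarrow> bool" where
  "is_inverse A B \<longleftrightarrow>
     row_finite A \<and> row_finite B \<and> is_identity (infmat_mult A B) \<and> is_identity (infmat_mult B A)"

text \<open>
  Two-sided inverses of row-finite matrices are unique on indices \<open>\<ge> 1\<close>; fixing the meaningless
  values at index 0 to be 0 singles out one function.
\<close>

definition infmat_inverse :: "infmat \<Rightarrow> infmat" where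
  "infmat_inverse A = (THE B. is_inverse A B \<and> (\<forall>i j. i = 0 \<or> j = 0 \<longrightarrow> B i j = 0))"

definition tilde1 :: "infmat \<Rightarrow> infmat" where
  "tilde1 M = (\<lambda>i j.
     if i = j then 1
     else if i = j + 1 then - 1
     else if i \<ge> j + 2 then - M (i - 1) j
     else 0)"

definition eigentriangle :: "infmat \<Rightarrow> infmat \<Rightarrow> bool" where
  "eigentriangle M R \<longleftrightarrow>
     lower_triangular R \<and> (\<forall>i\<ge>1. R i i = 1) \<and> (\<forall>i\<ge>1. R (i + 1) i = 1) \<and>
     (\<forall>i\<ge>1. \<forall>j\<ge>1. infmat_mult M R i j = (if i \<ge> j then R (i + 1) j else 0))"

end

theory Submission imports Defs begin

text \<open>
  Forward substitution yields a right inverse \<open>X\<close> of a lower unitriangular matrix \<open>A\<close>. It is again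
  lower unitriangular, hence has a right inverse \<open>Y\<close>, and associativity gives \<open>A = A X Y = Y\<close>; so
  \<open>X\<close> is a two-sided inverse. With \<open>A = tilde1 M\<close>, row \<open>i + 1\<close> of \<open>A R = I\<close> reads
  \<open>R (i + 1) j = (M R) i j + \<delta> (i + 1) j\<close>.
\<close>

definition unitriangular :: "infmat \<Rightarrow> bool" where
  "unitriangular A \<longleftrightarrow> lower_triangular A \<and> (\<forall>i\<ge>1. A i i = 1)"

text \<open>The upper limit \<open>n\<close> is left free so that one range can serve several rows
  at once (rows \<open>k \<le> i\<close> in a double sum) or be enlarged to contain a given
  column.\<close>

lemma infmat_mult_lower_triangular:
  assumes "lower_triangular A" "1 \<le> i" "i \<le> n"
  shows "infmat_mult A B i j = (\<Sum>k=1..n. A i k * B k j)"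
  unfolding infmat_mult_def
proof (rule sum.mono_neutral_cong_left)
  show "{k. 1 \<le> k \<and> A i k \<noteq> 0} \<subseteq> {1..n}"
    using assms unfolding lower_triangular_def by (force simp: not_less[symmetric])
qed auto

lemma lower_triangular_imp_row_finite:
  assumes "lower_triangular A"
  shows "row_finite A"
  unfolding row_finite_def
proof (intro allI impI)
  fix i :: nat assume "1 \<le> i"
  then have "{k. 1 \<le> k \<and> A i k \<noteq> 0} \<subseteq> {1..i}"
    using assms unfolding lower_triangular_def by (force simp: not_less[symmetric])
  then show "finite {k. 1 \<le> k \<and> A i k \<noteq> 0}"
    by (rule finite_subset) simp
qed

text \<open>With the diagonal term split off, the remaining sum involves only rows of
  \<open>B\<close> before row \<open>i\<close>. This is the form that makes induction and recursion
  on the row possible.\<close>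

lemma infmat_mult_unitriangular:
  assumes "unitriangular A" "1 \<le> i"
  shows "infmat_mult A B i j = (\<Sum>k=1..<i. A i k * B k j) + B i j"
proof -
  have "infmat_mult A B i j = (\<Sum>k=1..i. A i k * B k j)"
    using assms by (intro infmat_mult_lower_triangular) (auto simp: unitriangular_def)
  also have "{1..i} = insert i {1..<i}"
    using assms(2) by auto
  finally show ?thesis
    using assms by (simp add: unitriangular_def)
qed

text \<open>Lower-triangularity confines all three left factors to the common finite range
  \<open>1..i\<close>, so both sides are finite double sums that differ by an exchange of
  summation.\<close>

lemma infmat_mult_assoc:
  assumes "lower_triangular A" "lower_triangular B" "lower_triangular (infmat_mult A B)" "1 \<le> i"
  shows "infmat_mult (infmat_mult A B) C i j = infmat_mult A (infmat_mult B C) i j"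
proof -
  have "infmat_mult (infmat_mult A B) C i j
      = (\<Sum>l=1..i. (\<Sum>k=1..i. A i k * B k l) * C l j)"
    using assms by (simp add: infmat_mult_lower_triangular[where n=i])
  also have "\<dots> = (\<Sum>k=1..i. A i k * (\<Sum>l=1..i. B k l * C l j))"
    unfolding sum_distrib_left sum_distrib_right mult.assoc by (rule sum.swap)
  also have "\<dots> = infmat_mult A (infmat_mult B C) i j"
    using assms by (simp add: infmat_mult_lower_triangular[where n=i])
  finally show ?thesis .
qed

lemma unitriangular_right_inverse_unique:
  assumes "unitriangular A"
    and "is_identity (infmat_mult A B)" "is_identity (infmat_mult A C)"
    and "1 \<le> i" "1 \<le> j"
  shows "B i j = C i j"
  using assms(4)
proof (induction i rule: less_induct)
  case (less i)
  have "infmat_mult A B i j = infmat_mult A C i j"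
    using assms(2,3,5) less.prems by (simp add: is_identity_def)
  moreover have "(\<Sum>k=1..<i. A i k * B k j) = (\<Sum>k=1..<i. A i k * C k j)"
    using less.IH by (intro sum.cong) auto
  ultimately show ?case
    using assms(1) less.prems by (simp add: infmat_mult_unitriangular)
qed

text \<open>Solves \<open>A X = I\<close> row by row for unitriangular \<open>A\<close>: row
  \<open>i\<close> uses only the rows \<open>k < i\<close> already found. The value 0 at index 0
  matches the normalization in \<open>infmat_inverse\<close>.\<close>

fun forward_subst :: "infmat \<Rightarrow> infmat" where
  "forward_subst A i j =
     (if i = 0 \<or> j = 0 then 0
      else (if i = j then 1 else 0) - (\<Sum>k=1..<i. A i k * forward_subst A k j))"

declare forward_subst.simps[simp del]

lemma forward_subst_right_inverse:
  assumes "unitriangular A"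
  shows "is_identity (infmat_mult A (forward_subst A))"
  unfolding is_identity_def
proof (intro allI impI)
  fix i j :: nat assume "1 \<le> i" "1 \<le> j"
  then show "infmat_mult A (forward_subst A) i j = (if i = j then 1 else 0)"
    using assms by (simp add: infmat_mult_unitriangular forward_subst.simps[of A i j])
qed

lemma forward_subst_upper:
  "i < j \<Longrightarrow> forward_subst A i j = 0"
proof (induction i rule: less_induct)
  case (less i)
  then have "(\<Sum>k=1..<i. A i k * forward_subst A k j) = 0"
    by (intro sum.neutral) auto
  with less.prems show ?case
    by (simp add: forward_subst.simps[of A i j])
qed

text \<open>The recursion reads \<open>A\<close> only strictly below the diagonal, and in column
  \<open>i\<close> the rows before \<open>i\<close> are already zero, so the diagonal entry is the 1
  of the identity.\<close>

lemma unitriangular_forward_subst: "unitriangular (forward_subst A)"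
  unfolding unitriangular_def lower_triangular_def
proof (intro conjI allI impI)
  fix i :: nat assume "1 \<le> i"
  moreover have "(\<Sum>k=1..<i. A i k * forward_subst A k i) = 0"
    by (intro sum.neutral) (simp add: forward_subst_upper)
  ultimately show "forward_subst A i i = 1"
    by (simp add: forward_subst.simps[of A i i])
qed (rule forward_subst_upper)

lemma infmat_mult_cong_right:
  assumes "\<And>k. 1 \<le> k \<Longrightarrow> B k j = C k j"
  shows "infmat_mult A B i j = infmat_mult A C i j"
  unfolding infmat_mult_def using assms by (intro sum.cong) auto

lemma infmat_mult_identity_left:
  assumes "is_identity I" "1 \<le> i"
  shows "infmat_mult I B i j = B i j"
proof -
  have "unitriangular I"
    using assms(1) by (auto simp: unitriangular_def lower_triangular_def is_identity_def)
  moreover have "(\<Sum>k=1..<i. I i k * B k j) = 0"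
    using assms by (intro sum.neutral) (auto simp: is_identity_def)
  ultimately show ?thesis
    using assms(2) by (simp add: infmat_mult_unitriangular)
qed

lemma infmat_mult_identity_right:
  assumes "lower_triangular A" "is_identity I" "1 \<le> i" "1 \<le> j"
  shows "infmat_mult A I i j = A i j"
proof -
  \<comment> \<open>The limit \<open>max i j\<close> puts column \<open>j\<close> in the range even
    above the diagonal, which avoids a case distinction.\<close>
  have "infmat_mult A I i j = (\<Sum>k=1..max i j. A i k * I k j)"
    using assms by (intro infmat_mult_lower_triangular) auto
  also have "\<dots> = (\<Sum>k=1..max i j. if k = j then A i k else 0)"
    using assms by (intro sum.cong) (auto simp: is_identity_def)
  finally show ?thesis
    using assms(4) by (simp add: sum.delta)
qed

lemma forward_subst_is_inverse:
  assumes "unitriangular A"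
  shows "is_inverse A (forward_subst A)"
proof -
  define X Y where "X = forward_subst A" and "Y = forward_subst X"
  have X: "unitriangular X" and AX: "is_identity (infmat_mult A X)"
    and XY: "is_identity (infmat_mult X Y)"
    using assms by (simp_all add: X_def Y_def unitriangular_forward_subst forward_subst_right_inverse)
  have low: "lower_triangular A" "lower_triangular X" "lower_triangular (infmat_mult A X)"
    using assms X AX by (auto simp: unitriangular_def is_identity_def lower_triangular_def)
  have YA: "Y i j = A i j" if "1 \<le> i" "1 \<le> j" for i j
  proof -
    have "Y i j = infmat_mult (infmat_mult A X) Y i j"
      using AX that by (simp add: infmat_mult_identity_left)
    also have "\<dots> = infmat_mult A (infmat_mult X Y) i j"
      using low that by (simp add: infmat_mult_assoc)
    also have "\<dots> = A i j"
      using low(1) XY that by (rule infmat_mult_identity_right)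
    finally show ?thesis .
  qed
  \<comment> \<open>\<open>Y\<close> and \<open>A\<close> are known to agree only at positive
    indices, so the equality passes through the product entrywise.\<close>
  have "infmat_mult X A i j = infmat_mult X Y i j" if "1 \<le> i" "1 \<le> j" for i j
    using YA that by (intro infmat_mult_cong_right) auto
  with XY have "is_identity (infmat_mult X A)"
    by (simp add: is_identity_def)
  with AX low show ?thesis
    unfolding is_inverse_def X_def[symmetric] by (simp add: lower_triangular_imp_row_finite)
qed

lemma infmat_inverse_unitriangular:
  assumes "unitriangular A"
  shows "infmat_inverse A = forward_subst A"
  unfolding infmat_inverse_def
proof (rule the_equality)
  show "is_inverse A (forward_subst A) \<and> (\<forall>i j. i = 0 \<or> j = 0 \<longrightarrow> forward_subst A i j = 0)"
    using assms by (simp add: forward_subst_is_inverse forward_subst.simps)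
next
  fix B assume B: "is_inverse A B \<and> (\<forall>i j. i = 0 \<or> j = 0 \<longrightarrow> B i j = 0)"
  show "B = forward_subst A"
  proof (intro ext)
    fix i j
    show "B i j = forward_subst A i j"
    \<comment> \<open>At index 0 both functions are normalized to 0; elsewhere both are right
      inverses of \<open>A\<close>.\<close>
    proof (cases "i = 0 \<or> j = 0")
      case True
      with B show ?thesis by (auto simp: forward_subst.simps)
    next
      case False
      with assms B show ?thesis
        by (intro unitriangular_right_inverse_unique[of A])
          (auto simp: is_inverse_def forward_subst_right_inverse)
    qed
  qed
qed

lemma unitriangular_tilde1: "unitriangular (tilde1 M)"
  by (simp add: unitriangular_def lower_triangular_def tilde1_def)

text \<open>Left of the diagonal, row \<open>i + 1\<close> of \<open>tilde1 M\<close> is the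
  negative of row \<open>i\<close> of \<open>M\<close>: its entry -1 in column \<open>i\<close>
  equals \<open>- M i i\<close> because \<open>M\<close> has unit diagonal.\<close>

lemma infmat_mult_tilde1_Suc:
  assumes "unitriangular M" "1 \<le> i"
  shows "infmat_mult (tilde1 M) R (Suc i) j = R (Suc i) j - infmat_mult M R i j"
proof -
  have "(\<Sum>k=1..<i. tilde1 M (Suc i) k * R k j) = - (\<Sum>k=1..<i. M i k * R k j)"
    unfolding sum_negf[symmetric] by (intro sum.cong) (auto simp: tilde1_def)
  moreover have "tilde1 M (Suc i) i = -1"
    by (simp add: tilde1_def)
  ultimately show ?thesis
    using assms by (simp add: infmat_mult_unitriangular unitriangular_tilde1)
qed

theorem proposition10:
  fixes M R :: infmat
  assumes "lower_triangular M"
    and "\<And>i. i \<ge> 1 \<Longrightarrow> M i i = 1"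
    and "R = infmat_inverse (tilde1 M)"
  shows "is_inverse (tilde1 M) R \<and>
    eigentriangle M R \<and>
    lower_triangular R \<and>
    (\<forall>i\<ge>1. R i i = 1) \<and>
    (\<forall>i\<ge>1. R (i + 1) i = 1) \<and>
    (\<forall>i j. i \<ge> j \<and> j \<ge> 1 \<longrightarrow> infmat_mult M R i j = R (i + 1) j) \<and>
    (\<forall>i\<ge>1. infmat_mult M R i i = 1) \<and>
    (\<forall>i j. 1 \<le> i \<and> i < j \<longrightarrow> infmat_mult M R i j = 0)"
proof -
  have M: "unitriangular M"
    using assms(1,2) by (simp add: unitriangular_def)
  have R_eq: "R = forward_subst (tilde1 M)"
    using assms(3) by (simp add: infmat_inverse_unitriangular unitriangular_tilde1)
  then have inv: "is_inverse (tilde1 M) R" and "unitriangular R"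
    by (simp_all add: forward_subst_is_inverse unitriangular_tilde1 unitriangular_forward_subst)
  then have low: "lower_triangular R" and diag: "\<forall>i\<ge>1. R i i = 1"
    by (simp_all add: unitriangular_def)
  have shift: "infmat_mult M R i j = R (Suc i) j - (if Suc i = j then 1 else 0)"
    if "1 \<le> i" "1 \<le> j" for i j
    using inv that infmat_mult_tilde1_Suc[OF M that(1), of R j]
    by (simp add: is_inverse_def is_identity_def)
  have below: "infmat_mult M R i j = R (i + 1) j" if "j \<le> i" "1 \<le> j" for i j
    using shift[of i j] that by simp
  \<comment> \<open>For \<open>j = i + 1\<close> the diagonal entry of \<open>R\<close> cancels the
    1 of the identity; for larger \<open>j\<close> both terms of \<open>shift\<close>
    vanish.\<close>
  have above: "infmat_mult M R i j = 0" if "1 \<le> i" "i < j" for i j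
    using shift[of i j] that low diag by (cases "Suc i = j") (auto simp: lower_triangular_def)
  have MR_diag: "infmat_mult M R i i = 1" if "1 \<le> i" for i
  proof -
    have "(\<Sum>k=1..<i. M i k * R k i) = 0"
      using low by (intro sum.neutral) (auto simp: lower_triangular_def)
    with M diag that show ?thesis
      by (simp add: infmat_mult_unitriangular)
  qed
  \<comment> \<open>The subdiagonal of \<open>R\<close> is read off from the diagonal of
    \<open>M R\<close>, which was computed directly from the two unit diagonals.\<close>
  have subdiag: "R (i + 1) i = 1" if "1 \<le> i" for i
    using below[of i i] MR_diag[of i] that by simp
  have "eigentriangle M R"
    using low diag subdiag below above by (simp add: eigentriangle_def)
  with inv low diag subdiag below above MR_diag show ?thesis
    by blast
qed

end
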